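(* Let $n \ge 1$ be an integer and let $r > 1$ be any factor (prime or composite) of the Fermat number $F_{n-1} = 2^{2^{n-1}}+1$. Then the smallest positive integer $\nu$ such that $2^{\nu} \equiv 1 \pmod r$ is $\nu = 2^n$.
   Context: The Fermat numbers are $F_k = 2^{2^k}+1$ for integers $k\ge 0$. *)

theory Defs
  imports "HOL-Number_Theory.Number_Theory"
begin

definition fermat_number :: "nat \<Rightarrow> nat" where
  "fermat_number k = 2 ^ (2 ^ k) + 1"

end

theory Submission
  imports Defs
begin

text \<open>With \<open>x = 2 ^ (2 ^ (n - 1))\<close>, the hypothesis says that x is -1 modulo r.
  Squaring gives 2^(2^n) = 1 modulo r, so the order of 2 divides 2^n and is itself a power of 2. If
  it were a smaller one, it would divide 2^(n-1), making x both 1 and -1 modulo r; then r divides 2,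
  which is impossible since r > 1 divides the odd number x + 1.\<close>

theorem proposition2:
  fixes n r :: nat
  assumes "n \<ge> 1"
    and "r > 1"
    and "r dvd fermat_number (n - 1)"
  shows "ord r 2 = 2 ^ n"
proof -
  obtain m where n: "n = Suc m"
    using assms(1) by (cases n) auto
  define x :: nat where "x = 2 ^ (2 ^ m)"
  have dvd: "r dvd x + 1"
    using assms(3) by (simp add: n fermat_number_def x_def)
  have "even x"
    by (simp add: x_def)
  have not_one: "\<not> [x = 1] (mod r)"
  proof
    assume "[x = 1] (mod r)"
    then have "[x + 1 = 1 + 1] (mod r)"
      by (rule cong_add) simp
    with dvd have "r dvd 1 + 1"
      using cong_dvd_iff by blast
    then have "r = 2"
      using assms(2) dvd_imp_le [of r 2] by (simp add: numeral_2_eq_2)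
    with dvd \<open>even x\<close> show False
      by simp
  qed
  have "x ^ 2 - 1 = (x + 1) * (x - 1)"
    by (simp add: power2_eq_square algebra_simps)
  then have "r dvd x ^ 2 - 1"
    using dvd by (metis dvd_mult2)
  \<comment> \<open>Subtraction on \<open>nat\<close> truncates, so this bound is needed to read the
    divisibility of \<open>x ^ 2 - 1\<close> as a congruence.\<close>
  moreover have "1 \<le> x ^ 2"
    by (simp add: x_def)
  ultimately have "[x ^ 2 = 1] (mod r)"
    by (simp add: cong_altdef_nat)
  then have "[2 ^ (2 ^ n) = 1] (mod r)"
    by (simp add: n x_def power_mult [symmetric] mult.commute)
  then have "ord r 2 dvd 2 ^ n"
    by (simp only: ord_divides)
  then obtain k where k: "k \<le> n" "ord r 2 = 2 ^ k"
    by (auto simp: divides_primepow_nat)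
  \<comment> \<open>Since \<open>n = Suc m\<close>, ruling out all exponents up to \<open>m\<close>
    leaves only \<open>k = n\<close>.\<close>
  have "\<not> k \<le> m"
  proof
    assume "k \<le> m"
    then have "ord r 2 dvd 2 ^ m"
      by (simp add: k le_imp_power_dvd)
    with not_one show False
      unfolding x_def ord_divides by contradiction
  qed
  with k n show ?thesis
    by (simp add: le_Suc_eq)
qed

end
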